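(* An undirected graph $H$ is $\alpha$-acyclic if and only if $H$ contains no induced copy of the cycle $C_k$ for every $k\geq 6$.
   Context: A hypergraph $F$ is $\alpha$-acyclic if there is a tree $T$ whose vertices are the hyperedges of $F$ such that for all hyperedges $e_1,e_2,e$, if $e$ lies on the unique path in $T$ between $e_1$ and $e_2$ then $e_1\cap e_2\subseteq e$. For a directed acyclic graph $\vec H$ and a vertex $u$, $R(u)$ denotes the set of vertices reachable from $u$ by a directed path (so $u\in R(u)$). If $u_1,\dots,u_r$ are the sources of $\vec H$, the associated hypergraph has vertex set $V(\vec H)$ and hyperedges $R(u_1),\dots,R(u_r)$; $\vec H$ is $\alpha$-acyclic if this hypergraph is $\alpha$-acyclic. An undirected graph $H$ is $\alpha$-acyclic if every acyclic orientation of $H$ is $\alpha$-acyclic. $C_k$ denotes the cycle of length $k$. *)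

theory Defs
  imports "Graph_Theory.Digraph_Isomorphism" "Graph_Theory.Digraph_Component"
begin

text \<open>
  Finite simple undirected graphs are the finite, loop-free, symmetric digraphs without
  parallel arcs of the locale \<^locale>\<open>pair_graph\<close>: the edge joining u and v is represented by
  the two arcs (u,v) and (v,u).
\<close>

subsection \<open>Hypergraphs\<close>

text \<open>
  The library's \<^const>\<open>tree\<close> only forbids directed cycles, and on a symmetric digraph it
  already rejects a single edge, because the closed walk u, v, u counts as a cycle.  A cycle of an
  undirected graph is a library cycle with at least 3 arcs.  The null graph counts as a tree here,
  so that the hypergraph without hyperedges (and with it the null graph) is alpha-acyclic; the
  library's \<^const>\<open>connected\<close> would exclude it.
\<close>

definition undirected_tree :: "'a pair_pre_digraph \<Rightarrow> bool" where
  "undirected_tree T \<longleftrightarrow>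
     pair_graph T \<and>
     (\<forall>u \<in> pverts T. \<forall>v \<in> pverts T. u \<rightarrow>\<^sup>*\<^bsub>with_proj T\<^esub> v) \<and>
     \<not> (\<exists>p. pre_digraph.cycle (with_proj T) p \<and> 3 \<le> length p)"

record 'a hypergraph =
  hverts :: "'a set"
  hedges :: "'a set set"

definition alpha_acyclic_hypergraph :: "'a hypergraph \<Rightarrow> bool" where
  "alpha_acyclic_hypergraph F \<longleftrightarrow>
     (\<exists>T :: 'a set pair_pre_digraph.
        undirected_tree T \<and> pverts T = hedges F \<and>
        (\<forall>e1 \<in> hedges F. \<forall>e2 \<in> hedges F. \<forall>e \<in> hedges F. \<forall>p.
           pre_digraph.apath (with_proj T) e1 p e2 \<and>
           e \<in> set (pre_digraph.awalk_verts (with_proj T) e1 p) \<longrightarrow>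
           e1 \<inter> e2 \<subseteq> e))"

subsection \<open>Directed acyclic graphs\<close>

definition sources :: "'a pair_pre_digraph \<Rightarrow> 'a set" where
  "sources D = {u \<in> pverts D. in_arcs (with_proj D) u = {}}"

definition reach_set :: "'a pair_pre_digraph \<Rightarrow> 'a \<Rightarrow> 'a set" where
  "reach_set D u = {v. u \<rightarrow>\<^sup>*\<^bsub>with_proj D\<^esub> v}"

text \<open>
  In an acyclic digraph different sources have different reachability sets, so that nothing is
  lost by collecting the hyperedges in a set.
\<close>

definition source_hypergraph :: "'a pair_pre_digraph \<Rightarrow> 'a hypergraph" where
  "source_hypergraph D = \<lparr>hverts = pverts D, hedges = reach_set D ` sources D\<rparr>"

definition alpha_acyclic_dag :: "'a pair_pre_digraph \<Rightarrow> bool" where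
  "alpha_acyclic_dag D \<longleftrightarrow> alpha_acyclic_hypergraph (source_hypergraph D)"

subsection \<open>Undirected graphs\<close>

definition acyclic_orientation :: "'a pair_pre_digraph \<Rightarrow> 'a pair_pre_digraph \<Rightarrow> bool" where
  "acyclic_orientation H D \<longleftrightarrow>
     pverts D = pverts H \<and> parcs D \<subseteq> parcs H \<and>
     (\<forall>u v. (u, v) \<in> parcs H \<longrightarrow> ((u, v) \<in> parcs D \<longleftrightarrow> (v, u) \<notin> parcs D)) \<and>
     acyclic (parcs D)"

definition alpha_acyclic_graph :: "'a pair_pre_digraph \<Rightarrow> bool" where
  "alpha_acyclic_graph H \<longleftrightarrow> (\<forall>D. acyclic_orientation H D \<longrightarrow> alpha_acyclic_dag D)"

text \<open>The cycle of length k on the vertices 0, ..., k - 1, meaningful for k at least 3.\<close>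

definition cycle_graph :: "nat \<Rightarrow> nat pair_pre_digraph" where
  "cycle_graph k =
     \<lparr>pverts = {0..<k},
      parcs = {(i, j). i < k \<and> j < k \<and> (j = Suc i mod k \<or> i = Suc j mod k)}\<rparr>"

definition contains_induced_copy :: "'a pair_pre_digraph \<Rightarrow> 'b pair_pre_digraph \<Rightarrow> bool" where
  "contains_induced_copy H C \<longleftrightarrow>
     (\<exists>K. induced_subgraph K (with_proj H) \<and> digraph_iso K (with_proj C))"

end

theory Submission
  imports Defs
begin

text \<open>
  A long induced cycle is oriented with exactly three sources and three sinks, so that each sink is
  reached from exactly two of the sources, and all other edges at the cycle are directed away from
  it. Two hyperedges that are the only ones containing some vertex are adjacent in every join tree,
  which would thus contain a triangle.

  Conversely, fix a hyperedge \<open>g\<close> and choose another one, \<open>f\<close>, with \<open>f \<inter> g\<close> maximal. Walk from \<open>f\<close>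
  through hyperedges that meet outside \<open>g\<close>. If all hyperedges are reached and meet \<open>g\<close> inside \<open>f\<close>,
  then \<open>g\<close> can be attached to \<open>f\<close> as a leaf; if some are not reached, \<open>g\<close> separates the hypergraph and
  two join trees are glued at \<open>g\<close>. Otherwise there are \<open>x, y \<in> g\<close> and hyperedges connected outside
  \<open>g\<close> that cover both \<open>x\<close> and \<open>y\<close>, but none of which contains both. For reachability sets, a shortest
  path inside \<open>g\<close> between the ancestors of \<open>x\<close> and those of \<open>y\<close> that can be entered from outside, and a
  shortest path outside \<open>g\<close> that returns, have at least three vertices each and form an induced cycle.
\<close>

subsection \<open>Induced copies and reachability sets\<close>

text \<open>The isomorphism runs from the subgraph to \<open>C\<close> and has its own arc map.
  Tails and heads are projections on both sides, so the vertex map determines the arc map, and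
  inverting the vertex map gives the embedding.\<close>

lemma contains_induced_copyD:
  assumes "contains_induced_copy H C"
  obtains \<phi> where "inj_on \<phi> (pverts C)" "\<phi> ` pverts C \<subseteq> pverts H"
    "\<And>i j. i \<in> pverts C \<Longrightarrow> j \<in> pverts C \<Longrightarrow> (\<phi> i, \<phi> j) \<in> parcs H \<longleftrightarrow> (i, j) \<in> parcs C"
proof -
  from assms obtain K f where K: "induced_subgraph K (with_proj H)"
    and f: "pre_digraph.digraph_isomorphism K f" and C: "with_proj C = app_iso f K"
    unfolding contains_induced_copy_def digraph_iso_def by auto
  have tl: "tail K = fst" "head K = snd" and sub: "verts K \<subseteq> pverts H"
    and arcs: "arcs K = {e \<in> parcs H. fst e \<in> verts K \<and> snd e \<in> verts K}"
    using K by (auto simp: induced_subgraph_def subgraph_def compatible_def)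
  have wf: "wf_digraph K" and inj: "inj_on (iso_verts f) (verts K)"
    and ends: "\<And>a. a \<in> arcs K \<Longrightarrow> iso_verts f (fst a) = iso_tail f (iso_arcs f a)"
      "\<And>a. a \<in> arcs K \<Longrightarrow> iso_verts f (snd a) = iso_head f (iso_arcs f a)"
    using f unfolding pre_digraph.digraph_isomorphism_def tl by auto
  have pv: "pverts C = iso_verts f ` verts K" and pa: "parcs C = iso_arcs f ` arcs K"
    and tf: "iso_tail f = fst" "iso_head f = snd"
    using arg_cong[OF C, of verts] arg_cong[OF C, of arcs] arg_cong[OF C, of tail]
      arg_cong[OF C, of head] by simp_all
  define \<phi> where "\<phi> = the_inv_into (verts K) (iso_verts f)"
  have \<phi>: "\<phi> (iso_verts f v) = v" if "v \<in> verts K" for v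
    unfolding \<phi>_def using the_inv_into_f_f[OF inj that] .
  have arc: "iso_arcs f a = (iso_verts f (fst a), iso_verts f (snd a))" if "a \<in> arcs K" for a
    using ends[OF that] tf by (simp add: prod_eq_iff)
  have pa': "(iso_verts f u, iso_verts f v) \<in> parcs C \<longleftrightarrow> (u, v) \<in> parcs H"
    if "u \<in> verts K" "v \<in> verts K" for u v
  proof
    assume "(iso_verts f u, iso_verts f v) \<in> parcs C"
    then obtain a where a: "a \<in> arcs K" "iso_arcs f a = (iso_verts f u, iso_verts f v)"
      unfolding pa by auto
    have "fst a = u \<and> snd a = v"
      using a arc[OF a(1)] inj that arcs by (auto dest: inj_onD)
    then show "(u, v) \<in> parcs H" using a(1) arcs by (metis (no_types, lifting) mem_Collect_eq prod.collapse)
  next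
    assume "(u, v) \<in> parcs H"
    then have "(u, v) \<in> arcs K" using that arcs by simp
    then show "(iso_verts f u, iso_verts f v) \<in> parcs C"
      unfolding pa using arc[of "(u, v)"] by (metis fst_conv snd_conv image_eqI)
  qed
  show thesis
  proof
    show "inj_on \<phi> (pverts C)" unfolding pv by (auto simp: inj_on_def \<phi>)
    show "\<phi> ` pverts C \<subseteq> pverts H" unfolding pv using sub by (auto simp: \<phi>)
    show "\<And>i j. i \<in> pverts C \<Longrightarrow> j \<in> pverts C \<Longrightarrow> (\<phi> i, \<phi> j) \<in> parcs H \<longleftrightarrow> (i, j) \<in> parcs C"
      unfolding pv using pa' by (auto simp: \<phi>)
  qed
qed

lemma contains_induced_copyI:
  assumes wfH: "pair_wf_digraph H" and wfC: "pair_wf_digraph C"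
    and inj: "inj_on \<phi> (pverts C)" and sub: "\<phi> ` pverts C \<subseteq> pverts H"
    and adj: "\<And>i j. i \<in> pverts C \<Longrightarrow> j \<in> pverts C \<Longrightarrow> (\<phi> i, \<phi> j) \<in> parcs H \<longleftrightarrow> (i, j) \<in> parcs C"
  shows "contains_induced_copy H C"
proof -
  interpret H: pair_wf_digraph H by fact
  interpret C: pair_wf_digraph C by fact
  define K where "K = \<lparr>pverts = \<phi> ` pverts C,
    parcs = {e \<in> parcs H. fst e \<in> \<phi> ` pverts C \<and> snd e \<in> \<phi> ` pverts C}\<rparr>"
  interpret K: pair_wf_digraph K by unfold_locales (auto simp: K_def)
  define \<psi> where "\<psi> = the_inv_into (pverts C) \<phi>"
  have \<psi>: "\<psi> (\<phi> v) = v" if "v \<in> pverts C" for v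
    unfolding \<psi>_def using the_inv_into_f_f[OF inj that] .
  define f where "f = \<lparr>iso_verts = \<psi>, iso_arcs = map_prod \<psi> \<psi>, iso_head = snd, iso_tail = fst\<rparr>"
  have ind: "induced_subgraph (with_proj K) (with_proj H)"
    unfolding induced_subgraph_def subgraph_def
    using sub H.wf_digraph_axioms K.wf_digraph_axioms by (auto simp: K_def compatible_def)
  have inj\<psi>: "inj_on \<psi> (pverts K)" by (auto simp: K_def inj_on_def \<psi>)
  have iso: "pre_digraph.digraph_isomorphism (with_proj K) f"
    unfolding pre_digraph.digraph_isomorphism_def f_def
    using inj\<psi> K.wf_digraph_axioms K.in_arcsD1 K.in_arcsD2
      inj_on_subset[OF map_prod_inj_on[OF inj\<psi> inj\<psi>], of "parcs K"]
    by (simp add: subset_iff)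
  have "parcs C = map_prod \<psi> \<psi> ` parcs K"
  proof (intro set_eqI iffI)
    fix e assume e: "e \<in> parcs C"
    obtain i j where ij: "e = (i, j)" by force
    have v: "i \<in> pverts C" "j \<in> pverts C" using e ij C.in_arcsD1 C.in_arcsD2 by auto
    have "(\<phi> i, \<phi> j) \<in> parcs K" using adj[OF v] e v ij by (auto simp: K_def)
    moreover have "map_prod \<psi> \<psi> (\<phi> i, \<phi> j) = e" using v ij by (simp add: \<psi>)
    ultimately show "e \<in> map_prod \<psi> \<psi> ` parcs K" by (metis image_eqI)
  next
    fix e assume "e \<in> map_prod \<psi> \<psi> ` parcs K"
    then show "e \<in> parcs C" using adj by (auto simp: K_def \<psi>)
  qed
  moreover have "pverts C = \<psi> ` pverts K" by (force simp: K_def \<psi>)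
  ultimately have "with_proj C = app_iso f (with_proj K)"
    by (simp add: app_iso_def f_def with_proj_def)
  then show ?thesis
    unfolding contains_induced_copy_def digraph_iso_def using ind iso by blast
qed

lemma mem_pverts_cycle_graph [simp]: "i \<in> pverts (cycle_graph k) \<longleftrightarrow> i < k"
  by (simp add: cycle_graph_def)

lemma mem_parcs_cycle_graph [simp]:
  "(i, j) \<in> parcs (cycle_graph k) \<longleftrightarrow>
     i < k \<and> j < k \<and> (j = Suc i mod k \<or> i = Suc j mod k)"
  by (simp add: cycle_graph_def)

lemma pair_wf_digraph_cycle_graph: "pair_wf_digraph (cycle_graph k)"
  by unfold_locales (auto simp: cycle_graph_def)

section \<open>Reachability sets and sources\<close>

lemma reach_set_eq:
  assumes "pair_wf_digraph D" "u \<in> pverts D"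
  shows "reach_set D u = {v. (u, v) \<in> (parcs D)\<^sup>*}"
proof -
  interpret pair_wf_digraph D by fact
  have "v \<in> pverts D" if "(u, v) \<in> (parcs D)\<^sup>*" for v
    using that assms(2) by (induction rule: rtrancl_induct) (auto dest: in_arcsD2)
  then show ?thesis
    unfolding reach_set_def using assms(2) by (auto simp: reachable_conv)
qed

lemma mem_sources_iff:
  "u \<in> sources D \<longleftrightarrow> u \<in> pverts D \<and> (\<forall>v. (v, u) \<notin> parcs D)"
  by (auto simp: sources_def in_arcs_def)

lemma sources_rtrancl_eq:
  assumes "v \<in> sources D" "(u, v) \<in> (parcs D)\<^sup>*"
  shows "u = v"
  using assms(2,1) by (cases rule: rtrancl.cases) (auto simp: mem_sources_iff)

subsection \<open>Chordless paths and cycles\<close>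

text \<open>An induced path as a list. Testing only i < j suffices, since adjacency is symmetric
  wherever induced cycles are built from such lists.\<close>

definition chordless :: "('a \<Rightarrow> 'a \<Rightarrow> bool) \<Rightarrow> 'a list \<Rightarrow> bool" where
  "chordless E p \<longleftrightarrow> distinct p \<and>
     (\<forall>i j. i < j \<longrightarrow> j < length p \<longrightarrow> (E (p ! i) (p ! j) \<longleftrightarrow> j = Suc i))"

lemma rtrancl_imp_path:
  assumes "(a, b) \<in> {(u, v). E u v \<and> u \<in> S \<and> v \<in> S}\<^sup>*" "a \<in> S"
  shows "\<exists>p. p \<noteq> [] \<and> successively E p \<and> set p \<subseteq> S \<and> hd p = a \<and> last p = b"
  using assms
proof (induction rule: rtrancl_induct)
  case base
  then show ?case by (intro exI[of _ "[a]"]) auto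
next
  case (step b c)
  then obtain p where "p \<noteq> []" "successively E p" "set p \<subseteq> S" "hd p = a" "last p = b"
    by auto
  with step.hyps show ?case
    by (intro exI[of _ "p @ [c]"]) (auto simp: successively_append_iff)
qed

lemma last_take_Suc: "i < length p \<Longrightarrow> last (take (Suc i) p) = p ! i"
  by (simp add: take_Suc_conv_app_nth)

text \<open>A shortest path inside \<open>S\<close> that starts in \<open>A\<close> and ends in
  \<open>B\<close> has all these properties: a chord, a repeated vertex, a later vertex in
  \<open>A\<close> or an earlier one in \<open>B\<close> would each yield a shorter path.\<close>

lemma shortest_path_chordless:
  assumes conn: "(a, b) \<in> {(u, v). E u v \<and> u \<in> S \<and> v \<in> S}\<^sup>*"
    and "a \<in> S" "a \<in> A" "b \<in> B"
  obtains p where "p \<noteq> []" "set p \<subseteq> S" "chordless E p"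
    "\<And>i. i < length p \<Longrightarrow> p ! i \<in> A \<longleftrightarrow> i = 0"
    "\<And>i. i < length p \<Longrightarrow> p ! i \<in> B \<longleftrightarrow> i = length p - 1"
proof -
  define P where "P p \<longleftrightarrow> p \<noteq> [] \<and> successively E p \<and> set p \<subseteq> S \<and> hd p \<in> A \<and> last p \<in> B"
    for p
  have "\<exists>p. P p"
    using rtrancl_imp_path[OF conn \<open>a \<in> S\<close>] assms(3,4) unfolding P_def by auto
  then obtain p where p: "P p" and min: "\<And>q. P q \<Longrightarrow> length p \<le> length q"
    using ex_has_least_nat[of P _ length] by blast
  have p': "p \<noteq> []" "successively E p" "set p \<subseteq> S" "hd p \<in> A" "last p \<in> B"
    using p by (auto simp: P_def)
  have tk: "successively E (take n p)" for n
    using p'(2) by (metis append_take_drop_id successively_append_iff)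
  have dr: "successively E (drop n p)" for n
    using p'(2) by (metis append_take_drop_id successively_append_iff)
  have suc: "E (p ! i) (p ! Suc i)" if "Suc i < length p" for i
    using p'(2) that successively_nth by blast
  have A: "i = 0" if i: "i < length p" "p ! i \<in> A" for i
  proof (rule ccontr)
    assume "i \<noteq> 0"
    moreover have "P (drop i p)"
      unfolding P_def using i p' dr[of i] by (auto simp: hd_drop_conv_nth dest: in_set_dropD)
    ultimately show False using min[of "drop i p"] i by simp
  qed
  have B: "i = length p - 1" if i: "i < length p" "p ! i \<in> B" for i
  proof (rule ccontr)
    assume "i \<noteq> length p - 1"
    moreover have "P (take (Suc i) p)"
      unfolding P_def using i p' tk[of "Suc i"]
      by (auto simp: last_take_Suc hd_take dest: in_set_takeD)
    ultimately show False using min[of "take (Suc i) p"] i by simp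
  qed
  have chord: "j = Suc i" if ij: "i < j" "j < length p" "E (p ! i) (p ! j)" for i j
  proof (rule ccontr)
    assume "j \<noteq> Suc i"
    moreover have "P (take (Suc i) p @ drop j p)"
      unfolding P_def using ij p' tk[of "Suc i"] dr[of j]
      by (auto simp: last_take_Suc hd_take hd_drop_conv_nth successively_append_iff
          dest: in_set_takeD in_set_dropD)
    ultimately show False using min[of "take (Suc i) p @ drop j p"] ij by simp
  qed
  have dist: "p ! i \<noteq> p ! j" if ij: "i < j" "j < length p" for i j
  proof
    assume eq: "p ! i = p ! j"
    \<comment> \<open>The closed stretch between the two occurrences is cut out. If \<open>j\<close>
      is the last index, nothing follows and p ! i is itself the endpoint in
      \<open>B\<close>.\<close>
    have "P (take (Suc i) p @ drop (Suc j) p)"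
    proof (cases "Suc j = length p")
      case True
      then have "last p = p ! j" using p'(1) by (simp add: last_conv_nth flip: True)
      then show ?thesis
        unfolding P_def using ij p' tk[of "Suc i"] eq True
        by (auto simp: last_take_Suc hd_take dest: in_set_takeD)
    next
      case False
      then show ?thesis
        unfolding P_def using ij p' tk[of "Suc i"] dr[of "Suc j"] eq suc[of j]
        by (auto simp: last_take_Suc hd_take hd_drop_conv_nth successively_append_iff
            dest: in_set_takeD in_set_dropD)
    qed
    then show False using min[of "take (Suc i) p @ drop (Suc j) p"] ij by simp
  qed
  have "distinct p"
    unfolding distinct_conv_nth using dist by (metis nat_neq_iff)
  then have "chordless E p" unfolding chordless_def using chord suc by blast
  then show thesis
    using that[of p] p' A B by (metis hd_conv_nth last_conv_nth)
qed

text \<open>Reversing \<open>q\<close> puts its last vertex directly after the last one of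
  \<open>p\<close> and leaves its first vertex at the end, where the edge to the first vertex of
  \<open>p\<close> closes the cycle.\<close>

lemma chordless_cycle_append:
  assumes sym: "\<And>u v. E u v \<Longrightarrow> E v u"
    and p: "chordless E p" and q: "chordless E q" and disj: "set p \<inter> set q = {}"
    and len: "length p \<ge> 2" "length q \<ge> 2"
    and cross: "\<And>i j. i < length p \<Longrightarrow> j < length q \<Longrightarrow>
      E (p ! i) (q ! j) \<longleftrightarrow> i = 0 \<and> j = 0 \<or> i = length p - 1 \<and> j = length q - 1"
  defines "c \<equiv> p @ rev q"
  shows "distinct c"
    and "\<And>i j. i < j \<Longrightarrow> j < length c \<Longrightarrow>
      E (c ! i) (c ! j) \<longleftrightarrow> j = Suc i \<or> i = 0 \<and> j = length c - 1"
proof -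
  show "distinct c" using p q disj by (auto simp: c_def chordless_def)
  fix i j assume ij: "i < j" "j < length c"
  have cl: "length c = length p + length q" by (simp add: c_def)
  have P: "c ! i = p ! i" if "i < length p" for i using that by (simp add: c_def nth_append)
  have Q: "c ! i = q ! (length c - Suc i)" if "length p \<le> i" "i < length c" for i
    using that by (simp add: c_def nth_append rev_nth) (rule arg_cong[of _ _ "(!) q"], simp)
  consider "j < length p" | "i < length p" "length p \<le> j" | "length p \<le> i" by linarith
  then show "E (c ! i) (c ! j) \<longleftrightarrow> j = Suc i \<or> i = 0 \<and> j = length c - 1"
  proof cases
    case 1
    then show ?thesis using p ij cl len P[of i] P[of j] by (auto simp: chordless_def)
  next
    case 2
    have "length c - Suc j < length q" using 2 cl ij by linarith
    then have "E (c ! i) (c ! j) \<longleftrightarrow>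
        i = 0 \<and> length c - Suc j = 0 \<or> i = length p - 1 \<and> length c - Suc j = length q - 1"
      using cross[of i "length c - Suc j"] P[of i] Q[of j] 2 ij by simp
    also have "\<dots> \<longleftrightarrow> j = Suc i \<or> i = 0 \<and> j = length c - 1"
      using 2 ij cl len by auto
    finally show ?thesis .
  next
    case 3
    have "length c - Suc j < length c - Suc i" "length c - Suc i < length q"
      using 3 ij cl by linarith+
    then have "E (q ! (length c - Suc j)) (q ! (length c - Suc i)) \<longleftrightarrow>
        length c - Suc i = Suc (length c - Suc j)"
      using q by (simp add: chordless_def)
    then show ?thesis using Q[of i] Q[of j] 3 ij sym cl len by auto
  qed
qed

subsection \<open>Join trees\<close>

text \<open>The running intersection property, with the root of the join tree at the end of the list.\<close>
primrec rip :: "'a set list \<Rightarrow> bool" where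
  "rip [] \<longleftrightarrow> True"
| "rip (e # es) \<longleftrightarrow> rip es \<and> e \<notin> set es \<and> (es = [] \<or> (\<exists>f\<in>set es. e \<inter> \<Union>(set es) \<subseteq> f))"

text \<open>Each \<open>e\<close> of \<open>A\<close> keeps its old parent \<open>f\<close>: what
  \<open>e\<close> shares with hyperedges of \<open>B\<close> lies in \<open>g\<close>, and the part
  of \<open>e\<close> in \<open>g\<close> is already inside \<open>f\<close>.\<close>

lemma rip_glue:
  assumes "rip (A @ [g])" "rip (B @ [g])" "set A \<inter> set B = {}" "\<Union>(set A) \<inter> \<Union>(set B) \<subseteq> g"
  shows "rip (A @ B @ [g])"
  using assms
proof (induction A)
  case (Cons e A)
  then obtain f where f: "f \<in> insert g (set A)" "e \<inter> \<Union>(insert g (set A)) \<subseteq> f"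
    by auto
  have "e \<inter> \<Union>(set (A @ B @ [g])) \<subseteq> f"
    using f(2) Cons.prems(4) by auto
  moreover have "rip (A @ B @ [g])" using Cons by auto
  ultimately show ?case using f(1) Cons.prems by (auto simp del: Union_iff)
qed simp

text \<open>Although \<open>g\<close> is attached as a leaf at \<open>f\<close>, it is listed last
  and so becomes the new root. Earlier hyperedges meet \<open>g\<close> only inside
  \<open>f\<close>, so their parents still serve.\<close>

lemma rip_ear:
  assumes "rip (A @ [f])" "g \<notin> set (A @ [f])" "g \<inter> \<Union>(set A) \<subseteq> f"
  shows "rip (A @ [f, g])"
  using assms
proof (induction A)
  case (Cons e A)
  then obtain f' where f': "f' \<in> insert f (set A)" "e \<inter> \<Union>(insert f (set A)) \<subseteq> f'"
    by auto
  have "e \<inter> \<Union>(set (A @ [f, g])) \<subseteq> f'"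
    using f'(2) Cons.prems(3) by auto
  moreover have "rip (A @ [f, g])" using Cons by auto
  ultimately show ?case using f'(1) Cons.prems by (auto simp del: Union_iff)
qed auto

section \<open>Obstructions and the existence of a running intersection order\<close>

abbreviation outside :: "'a set \<Rightarrow> 'a set set \<Rightarrow> 'a set rel" where
  "outside g W \<equiv> {(a, b). a \<in> W \<and> b \<in> W \<and> \<not> a \<inter> b \<subseteq> g}"

text \<open>This is the configuration left over when a hyperedge can neither be attached nor used as
  a separator. It does not mention \<open>f\<close>, so an obstruction in a subfamily is also one in
  the whole family, as the induction requires.\<close>

definition obstruction :: "'a set set \<Rightarrow> 'a set \<Rightarrow> 'a set set \<Rightarrow> 'a \<Rightarrow> 'a \<Rightarrow> bool" where
  "obstruction U g W x y \<longleftrightarrow> g \<in> U \<and> W \<subseteq> U - {g} \<and> x \<in> g \<and> y \<in> g \<and>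
     x \<in> \<Union>W \<and> y \<in> \<Union>W \<and> (\<forall>e\<in>W. x \<in> e \<longrightarrow> y \<notin> e) \<and>
     (\<forall>a\<in>W. \<forall>b\<in>W. (a, b) \<in> (outside g W)\<^sup>*)"

lemma obstruction_mono: "obstruction U g W x y \<Longrightarrow> U \<subseteq> U' \<Longrightarrow> obstruction U' g W x y"
  unfolding obstruction_def by blast

text \<open>The root \<open>g\<close> is arbitrary in the induction: gluing needs two lists with the
  same root \<open>g\<close>, while attaching \<open>g\<close> needs a list with root
  \<open>f\<close>.\<close>

lemma rip_if_no_obstruction:
  assumes "finite U" "g \<in> U" "\<And>g W x y. \<not> obstruction U g W x y"
  shows "\<exists>A. rip (A @ [g]) \<and> set (A @ [g]) = U"
  using assms
proof (induction U arbitrary: g rule: finite_psubset_induct)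
  case (psubset U g)
  have no: "\<not> obstruction U' g' W x y" if "U' \<subseteq> U" for U' g' W x y
    using psubset.prems(2) obstruction_mono[OF _ that] by blast
  show ?case
  proof (cases "U = {g}")
    case True
    then show ?thesis by (intro exI[of _ "[]"]) auto
  next
    case False
    then have "(\<lambda>e. e \<inter> g) ` (U - {g}) \<noteq> {}" using psubset.prems(1) by auto
    moreover have "finite ((\<lambda>e. e \<inter> g) ` (U - {g}))" using psubset.hyps by simp
    ultimately obtain f where f: "f \<in> U - {g}"
      and max: "\<forall>t\<in>(\<lambda>e. e \<inter> g) ` (U - {g}). f \<inter> g \<le> t \<longrightarrow> f \<inter> g = t"
      using finite_has_maximal by (smt (verit, ccfv_threshold) imageE)
    \<comment> \<open>\<open>V\<close> collects the hyperedges that meet \<open>g\<close> inside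
      \<open>f\<close>, and \<open>W\<close> is the component of \<open>f\<close> in
      \<open>V\<close> with respect to intersections outside \<open>g\<close>.\<close>
    define V where "V = {e \<in> U - {g}. e \<inter> g \<subseteq> f}"
    define W where "W = (outside g V)\<^sup>* `` {f}"
    have fV: "f \<in> V" and fW: "f \<in> W" using f(1) by (auto simp: V_def W_def)
    have WV: "W \<subseteq> V"
    proof
      fix w assume "w \<in> W"
      then have "(f, w) \<in> (outside g V)\<^sup>*" by (simp add: W_def)
      then show "w \<in> V" using fV by (induction rule: rtrancl_induct) auto
    qed
    show ?thesis
    proof (cases "\<exists>h\<in>U - {g} - W. \<exists>w\<in>W. \<not> w \<inter> h \<subseteq> g")
      case True
      then obtain h w where h: "h \<in> U - {g} - W" and w: "w \<in> W" "\<not> w \<inter> h \<subseteq> g" by blast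
      have "h \<notin> V"
      proof
        assume "h \<in> V"
        then have "(w, h) \<in> outside g V" using w WV by auto
        then have "h \<in> W" using w(1) unfolding W_def by (auto intro: rtrancl_into_rtrancl)
        then show False using h by simp
      qed
      \<comment> \<open>As \<open>h\<close> is not in \<open>V\<close>, it has a point
        \<open>y\<close> of \<open>g\<close> outside \<open>f\<close>. If \<open>h\<close> contained
        all of f \<inter> g, maximality would make the two intersections with \<open>g\<close>
        equal, contradicting \<open>y\<close>; hence \<open>x\<close> exists.\<close>
      then obtain y where y: "y \<in> h" "y \<in> g" "y \<notin> f" using h by (auto simp: V_def)
      obtain x where x: "x \<in> f" "x \<in> g" "x \<notin> h"
        using bspec[OF max, of "h \<inter> g"] h y by blast
      let ?W = "insert h W"
      have conn: "(f, a) \<in> (outside g ?W)\<^sup>*" if "a \<in> W" for a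
      proof -
        have "(f, a) \<in> (outside g V)\<^sup>*" using that by (simp add: W_def)
        then show ?thesis
        proof (induction rule: rtrancl_induct)
          case (step b c)
          have "b \<in> W" using step.hyps(1) by (simp add: W_def)
          moreover have "c \<in> W" using rtrancl_into_rtrancl[OF step.hyps] by (simp add: W_def)
          ultimately have "(b, c) \<in> outside g ?W" using step.hyps(2) by auto
          then show ?case using step.IH by (rule rtrancl_into_rtrancl[rotated])
        qed simp
      qed
      have "(w, h) \<in> outside g ?W" using w by auto
      then have conn': "(f, a) \<in> (outside g ?W)\<^sup>*" if "a \<in> ?W" for a
        using conn[OF w(1)] conn that by (auto intro: rtrancl_into_rtrancl)
      have "sym ((outside g ?W)\<^sup>*)"
        by (rule sym_rtrancl, rule symI) (auto simp: Int_commute)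
      then have "(a, f) \<in> (outside g ?W)\<^sup>*" if "a \<in> ?W" for a
        using conn'[OF that] by (rule symD)
      then have "\<forall>a\<in>?W. \<forall>b\<in>?W. (a, b) \<in> (outside g ?W)\<^sup>*"
        using conn' by (blast intro: rtrancl_trans)
      \<comment> \<open>Members of \<open>W\<close> meet \<open>g\<close> inside \<open>f\<close>
        and so avoid \<open>y\<close>, while \<open>h\<close> avoids \<open>x\<close>.\<close>
      moreover have "\<forall>e\<in>?W. x \<in> e \<longrightarrow> y \<notin> e"
        using WV x y by (auto simp: V_def)
      moreover have "?W \<subseteq> U - {g}" using h WV by (auto simp: V_def)
      moreover have "x \<in> \<Union>?W" "y \<in> \<Union>?W" using x y fW by auto
      ultimately have "obstruction U g ?W x y"
        unfolding obstruction_def using psubset.prems(1) x(2) y(2) by (intro conjI)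
      then show ?thesis using psubset.prems(2) by blast
    next
      case sep: False
      show ?thesis
      proof (cases "W = U - {g}")
        case True
        obtain A where A: "rip (A @ [f])" "set (A @ [f]) = U - {g}"
          using psubset.IH[of "U - {g}" f] psubset.prems(1) f(1) no[of "U - {g}"] by auto
        have "g \<inter> \<Union>(set A) \<subseteq> f"
          using A(2) True WV by (auto simp: V_def)
        then have "rip (A @ [f, g])" using rip_ear A by blast
        then show ?thesis using A(2) psubset.prems(1) by (intro exI[of _ "A @ [f]"]) auto
      next
        case False
        have W: "W \<subseteq> U - {g}" using WV by (auto simp: V_def)
        \<comment> \<open>Both pieces contain \<open>g\<close> and are proper: the first misses some
          hyperedge since \<open>W\<close> is not everything, and the second misses
          \<open>f\<close>.\<close>
        have "insert g W \<subset> U" "U - W \<subset> U"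
          using W False fW psubset.prems(1) f(1) by auto
        moreover have "g \<in> U - W" using psubset.prems(1) W by auto
        ultimately obtain A B where A: "rip (A @ [g])" "set (A @ [g]) = insert g W"
          and B: "rip (B @ [g])" "set (B @ [g]) = U - W"
          using psubset.IH[OF _ _ no, of "insert g W" g] psubset.IH[OF _ _ no, of "U - W" g]
          by (metis insertI1 psubset_imp_subset)
        have gn: "g \<notin> set A" "g \<notin> set B"
        proof -
          have "rip (C @ [g]) \<Longrightarrow> g \<notin> set C" for C by (induction C) auto
          then show "g \<notin> set A" "g \<notin> set B" using A B by auto
        qed
        have "set A = W" "set B = U - {g} - W" using A(2) B(2) gn W by auto
        then have "set A \<inter> set B = {}" "\<Union>(set A) \<inter> \<Union>(set B) \<subseteq> g"
          using sep by blast+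
        from rip_glue[OF A(1) B(1) this]
        show ?thesis
          using A(2) B(2) W psubset.prems(1) by (intro exI[of _ "A @ B"]) auto
      qed
    qed
  qed
qed

section \<open>Join trees as symmetric relations, with paths and cycles as lists of distinct
  hyperedges\<close>

definition join_tree :: "'a set set \<Rightarrow> 'a set rel \<Rightarrow> bool" where
  "join_tree U T \<longleftrightarrow> T \<subseteq> U \<times> U \<and> sym T \<and> irrefl T \<and> (\<forall>u\<in>U. \<forall>v\<in>U. (u, v) \<in> T\<^sup>*) \<and>
     (\<forall>p. distinct p \<and> 3 \<le> length p \<and> successively (\<lambda>u v. (u, v) \<in> T) p \<longrightarrow>
       (last p, hd p) \<notin> T) \<and>
     (\<forall>p. p \<noteq> [] \<and> distinct p \<and> set p \<subseteq> U \<and> successively (\<lambda>u v. (u, v) \<in> T) p \<longrightarrow>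
       (\<forall>e\<in>set p. hd p \<inter> last p \<subseteq> e))"

text \<open>The only neighbour of \<open>e\<close> is \<open>f\<close>, so \<open>e\<close> lies on
  no cycle and can only be an end of a path. A path from \<open>e\<close> continues at
  \<open>f\<close>, and \<open>ef\<close> reduces its intersection condition to that of the
  remaining path.\<close>

lemma join_tree_add_leaf:
  assumes T: "join_tree U T" and f: "f \<in> U" and e: "e \<notin> U" and ef: "e \<inter> \<Union>U \<subseteq> f"
  defines "T' \<equiv> T \<union> {(e, f), (f, e)}"
  shows "join_tree (insert e U) T'"
proof -
  let ?s = "successively (\<lambda>u v. (u, v) \<in> T')"
  have sub: "T \<subseteq> U \<times> U" and "sym T" and "irrefl T"
    and con: "\<And>u v. u \<in> U \<Longrightarrow> v \<in> U \<Longrightarrow> (u, v) \<in> T\<^sup>*"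
    and cyc: "\<And>p. distinct p \<Longrightarrow> 3 \<le> length p \<Longrightarrow> successively (\<lambda>u v. (u, v) \<in> T) p \<Longrightarrow>
       (last p, hd p) \<notin> T"
    and path: "\<And>p d. p \<noteq> [] \<Longrightarrow> distinct p \<Longrightarrow> set p \<subseteq> U \<Longrightarrow>
       successively (\<lambda>u v. (u, v) \<in> T) p \<Longrightarrow> d \<in> set p \<Longrightarrow> hd p \<inter> last p \<subseteq> d"
    using T unfolding join_tree_def by blast+
  have nb: "(u, e) \<in> T' \<longleftrightarrow> u = f" "(e, u) \<in> T' \<longleftrightarrow> u = f" for u
    using sub e f by (auto simp: T'_def)
  have old: "successively (\<lambda>u v. (u, v) \<in> T) p" if "?s p" "e \<notin> set p" for p
    using successively_mono[OF that(1), of "\<lambda>u v. (u, v) \<in> T"] that(2) by (auto simp: T'_def)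
  \<comment> \<open>If \<open>e\<close> had vertices on both sides, \<open>f\<close> would be its
    neighbour on each side and occur twice.\<close>
  have nbr: "as = [] \<or> last as = f" "bs = [] \<or> hd bs = f" "as = [] \<or> bs = []"
    if "?s (as @ e # bs)" "distinct (as @ e # bs)" for as bs
  proof -
    show 1: "as = [] \<or> last as = f" and 2: "bs = [] \<or> hd bs = f"
      using that nb by (auto simp: successively_append_iff successively_Cons)
    have "f \<in> set as \<inter> set bs" if "as \<noteq> []" "bs \<noteq> []"
      using 1 2 that by (metis IntI hd_in_set last_in_set)
    then show "as = [] \<or> bs = []" using that by auto
  qed
  have "T' \<subseteq> insert e U \<times> insert e U" using sub f by (auto simp: T'_def)
  moreover have "sym T'" using \<open>sym T\<close> by (auto simp: T'_def sym_def)
  moreover have "irrefl T'" using \<open>irrefl T\<close> e f by (auto simp: T'_def irrefl_def)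
  moreover have "(u, v) \<in> T'\<^sup>*" if "u \<in> insert e U" "v \<in> insert e U" for u v
  proof -
    have "(a, b) \<in> T'\<^sup>*" if "a \<in> U" "b \<in> U" for a b
      using con[OF that] rtrancl_mono[of T T'] by (auto simp: T'_def)
    then have "(a, f) \<in> T'\<^sup>*" "(f, a) \<in> T'\<^sup>*" if "a \<in> insert e U" for a
      using that f nb by auto
    then show ?thesis using that by (meson rtrancl_trans)
  qed
  then have "\<forall>u\<in>insert e U. \<forall>v\<in>insert e U. (u, v) \<in> T'\<^sup>*" by blast
  moreover have "(last p, hd p) \<notin> T'" if p: "distinct p" "3 \<le> length p" "?s p" for p
  proof
    assume cl: "(last p, hd p) \<in> T'"
    show False
    proof (cases "e \<in> set p")
      case True
      then obtain as bs where p_eq: "p = as @ e # bs" by (meson split_list)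
      have sd: "?s (as @ e # bs)" "distinct (as @ e # bs)" using p p_eq by simp_all
      from nbr(3)[OF sd] consider "as = []" | "bs = []" by auto
      then show False
      proof cases
        case 1
        \<comment> \<open>The edge closing the cycle also ends at \<open>e\<close>, so the rest of
          the cycle would both start and end with \<open>f\<close> despite having at least two
          distinct vertices.\<close>
        then have "bs \<noteq> []" "tl bs \<noteq> []" using p(2) p_eq by (cases bs; auto)+
        moreover have "hd bs = f" using nbr(2)[OF sd] \<open>bs \<noteq> []\<close> by simp
        moreover have "last bs = f" using cl p_eq 1 nb(1) \<open>bs \<noteq> []\<close> by simp
        ultimately show False using sd(2) by (cases bs) (auto split: if_splits)
      next
        case 2
        then have "as \<noteq> []" "tl as \<noteq> []" using p(2) p_eq by (cases as; auto)+
        moreover have "last as = f" using nbr(1)[OF sd] \<open>as \<noteq> []\<close> by simp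
        moreover have "hd as = f" using cl p_eq 2 nb(2) \<open>as \<noteq> []\<close> by simp
        ultimately show False using sd(2) by (cases as) (auto split: if_splits)
      qed
    next
      case False
      moreover from False p(2) have "last p \<noteq> e" "hd p \<noteq> e"
        by (metis last_in_set hd_in_set list.size(3) not_numeral_le_zero)+
      ultimately show False
        using cyc[OF p(1,2) old[OF p(3)]] cl by (auto simp: T'_def)
    qed
  qed
  then have "\<forall>p. distinct p \<and> 3 \<le> length p \<and> ?s p \<longrightarrow> (last p, hd p) \<notin> T'" by blast
  moreover have "hd p \<inter> last p \<subseteq> d"
    if p: "p \<noteq> []" "distinct p" "set p \<subseteq> insert e U" "?s p" and d: "d \<in> set p" for p d
  proof (cases "e \<in> set p")
    case True
    then obtain as bs where p_eq: "p = as @ e # bs" by (meson split_list)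
    have sd: "?s (as @ e # bs)" "distinct (as @ e # bs)" using p p_eq by simp_all
    from nbr(3)[OF sd] p_eq consider
      "p = [e]" | "as = []" "bs \<noteq> []" | "as \<noteq> []" "bs = []" by auto
    then show ?thesis
    proof cases
      case 1
      then show ?thesis using d by auto
    next
      case 2
      have bs: "set bs \<subseteq> U" "hd bs = f" "e \<notin> set bs" "distinct bs" "?s bs"
        using nbr(2)[OF sd] sd p(3) p_eq 2 by (auto simp: successively_Cons)
      have "last bs \<in> U" using bs(1) 2 by auto
      then have "e \<inter> last bs \<subseteq> f" using ef by blast
      moreover have "f \<inter> last bs \<subseteq> d" if "d \<in> set bs"
        using path[OF 2(2) bs(4,1) old[OF bs(5,3)] that] bs(2) by simp
      ultimately show ?thesis using d p_eq 2 by auto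
    next
      case 3
      have as: "set as \<subseteq> U" "last as = f" "e \<notin> set as" "distinct as" "?s as"
        using nbr(1)[OF sd] sd p(3) p_eq 3 by (auto simp: successively_append_iff)
      have "hd as \<in> U" using as(1) 3 by auto
      then have "e \<inter> hd as \<subseteq> f" using ef by blast
      moreover have "hd as \<inter> f \<subseteq> d" if "d \<in> set as"
        using path[OF 3(1) as(4,1) old[OF as(5,3)] that] as(2) by simp
      ultimately show ?thesis using d p_eq 3 by auto
    qed
  next
    case False
    then show ?thesis using path[OF p(1,2) _ old[OF p(4)] d] p(3) by auto
  qed
  then have "\<forall>p. p \<noteq> [] \<and> distinct p \<and> set p \<subseteq> insert e U \<and> ?s p \<longrightarrow>
      (\<forall>d\<in>set p. hd p \<inter> last p \<subseteq> d)"
    by blast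
  ultimately show ?thesis unfolding join_tree_def by (intro conjI)
qed

lemma rip_imp_join_tree: "rip es \<Longrightarrow> \<exists>T. join_tree (set es) T"
proof (induction es)
  case Nil
  have "join_tree {} {}" unfolding join_tree_def by (auto simp: sym_def irrefl_def)
  then show ?case by auto
next
  case (Cons e es)
  show ?case
  proof (cases "es = []")
    case True
    have "\<forall>d\<in>set p. hd p \<inter> last p \<subseteq> d" if "p \<noteq> []" "set p \<subseteq> {e}" for p
    proof -
      have "hd p = e" using hd_in_set[OF that(1)] that(2) by blast
      then show ?thesis using that(2) by auto
    qed
    then have "join_tree {e} {}"
      unfolding join_tree_def by (auto simp: sym_def irrefl_def)
    then show ?thesis using True by auto
  next
    case False
    then obtain f where "f \<in> set es" "e \<inter> \<Union>(set es) \<subseteq> f" "e \<notin> set es"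
      using Cons.prems by auto
    then show ?thesis using Cons join_tree_add_leaf by fastforce
  qed
qed

section \<open>From join trees to trees built of arcs\<close>

lemma pawalk_verts_props:
  assumes "pcas u p v" "set p \<subseteq> parcs G" "u \<in> pverts G" "pair_wf_digraph G"
  shows "successively (\<lambda>u v. (u, v) \<in> parcs G) (pawalk_verts u p) \<and> hd (pawalk_verts u p) = u \<and>
    last (pawalk_verts u p) = v \<and> set (pawalk_verts u p) \<subseteq> pverts G \<and>
    length (pawalk_verts u p) = Suc (length p)"
  using assms(1-3)
proof (induction p arbitrary: u)
  case (Cons e p)
  have "snd e \<in> pverts G" "fst e \<in> pverts G"
    using Cons.prems(2) pair_wf_digraph.arc_fst_in_verts[OF assms(4)]
      pair_wf_digraph.arc_snd_in_verts[OF assms(4)] by simp_all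
  moreover from this have "successively (\<lambda>u v. (u, v) \<in> parcs G) (pawalk_verts (snd e) p) \<and>
      hd (pawalk_verts (snd e) p) = snd e \<and> last (pawalk_verts (snd e) p) = v \<and>
      set (pawalk_verts (snd e) p) \<subseteq> pverts G \<and>
      length (pawalk_verts (snd e) p) = Suc (length p)"
    using Cons by auto
  ultimately show ?case
    using Cons.prems by (auto simp: successively_Cons)
qed simp

lemma alpha_acyclic_hypergraphI:
  assumes fin: "finite (hedges F)" and T: "join_tree (hedges F) T"
  shows "alpha_acyclic_hypergraph F"
proof -
  define G where "G = \<lparr>pverts = hedges F, parcs = T\<rparr>"
  have [simp]: "pverts G = hedges F" "parcs G = T" by (simp_all add: G_def)
  have sub: "T \<subseteq> hedges F \<times> hedges F" and "sym T" and "irrefl T"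
    and con: "\<And>u v. u \<in> hedges F \<Longrightarrow> v \<in> hedges F \<Longrightarrow> (u, v) \<in> T\<^sup>*"
    and cyc: "\<And>p. distinct p \<Longrightarrow> 3 \<le> length p \<Longrightarrow> successively (\<lambda>u v. (u, v) \<in> T) p \<Longrightarrow>
       (last p, hd p) \<notin> T"
    and path: "\<And>p d. p \<noteq> [] \<Longrightarrow> distinct p \<Longrightarrow> set p \<subseteq> hedges F \<Longrightarrow>
       successively (\<lambda>u v. (u, v) \<in> T) p \<Longrightarrow> d \<in> set p \<Longrightarrow> hd p \<inter> last p \<subseteq> d"
    using T unfolding join_tree_def by blast+
  have "finite T" using sub fin finite_subset by blast
  interpret pair_graph G
    using sub fin \<open>finite T\<close> \<open>sym T\<close> \<open>irrefl T\<close>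
    by unfold_locales (auto simp: symmetric_def irrefl_def)
  have "\<not> (cycle p \<and> 3 \<le> length p)" for p
  proof
    assume p: "cycle p \<and> 3 \<le> length p"
    then obtain u where u: "awalk u p u" "distinct (tl (pawalk_verts u p))"
      unfolding cycle_def by auto
    let ?vs = "pawalk_verts u p"
    have vs: "successively (\<lambda>u v. (u, v) \<in> T) ?vs" "hd ?vs = u" "last ?vs = u"
      "length ?vs = Suc (length p)"
      using pawalk_verts_props[of u p u G] u(1) pair_wf_digraph_axioms
      unfolding awalk_def by simp_all
    \<comment> \<open>The vertex list of a closed walk names \<open>u\<close> at both ends. Dropping
      the first copy leaves a distinct list of at least three vertices, whose last vertex
      \<open>u\<close> is adjacent to its first vertex \<open>w\<close>.\<close>
    obtain w ws where ws: "?vs = u # w # ws"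
      using vs(2,4) p by (cases ?vs; cases "tl ?vs") auto
    have "(last (w # ws), hd (w # ws)) \<in> T" using vs ws by (auto simp: successively_Cons)
    moreover have "(last (w # ws), hd (w # ws)) \<notin> T"
      using cyc[of "w # ws"] u(2) vs p ws by (auto simp: successively_Cons)
    ultimately show False by simp
  qed
  then have tree: "undirected_tree G"
    unfolding undirected_tree_def using pair_graph_axioms con reachable_conv' by simp
  have "e1 \<inter> e2 \<subseteq> e" if "apath e1 p e2" "e \<in> set (pawalk_verts e1 p)" for e1 e2 e p
  proof -
    let ?vs = "pawalk_verts e1 p"
    have vs: "successively (\<lambda>u v. (u, v) \<in> T) ?vs" "hd ?vs = e1" "last ?vs = e2"
      "set ?vs \<subseteq> hedges F" "length ?vs = Suc (length p)" "distinct ?vs"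
      using pawalk_verts_props[of e1 p e2 G] that(1) pair_wf_digraph_axioms
      unfolding apath_def awalk_def by simp_all
    then show ?thesis using path[of ?vs e] that(2) by fastforce
  qed
  then show ?thesis
    unfolding alpha_acyclic_hypergraph_def using tree
    by (intro exI[of _ G] conjI ballI allI impI) (simp_all, blast)
qed

section \<open>Forced adjacencies in a join tree\<close>

lemma tree_adjacent:
  assumes "undirected_tree T"
    and sep: "\<And>e p. pre_digraph.apath (with_proj T) a p b \<Longrightarrow>
      e \<in> set (pawalk_verts a p) \<Longrightarrow> e = a \<or> e = b"
    and ab: "a \<in> pverts T" "b \<in> pverts T" "a \<noteq> b"
  shows "(a, b) \<in> parcs T"
proof -
  interpret pair_graph T using assms(1) by (simp add: undirected_tree_def)
  have "reachable (with_proj T) a b" using assms(1) ab by (simp add: undirected_tree_def)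
  then obtain p where p: "apath a p b" using reachable_apath by blast
  then have verts: "set (pawalk_verts a p) \<subseteq> {a, b}" using sep[OF p] by auto
  obtain e q where e: "p = e # q" using p ab(3) by (cases p) (auto simp: apath_Nil_iff)
  \<comment> \<open>The first arc of the path leaves \<open>a\<close> for good, and \<open>b\<close>
    is the only other vertex available.\<close>
  have *: "e \<in> parcs T" "fst e = a" "a \<notin> set (pawalk_verts (snd e) q)"
    using p unfolding e apath_Cons_iff by auto
  have "snd e \<in> set (pawalk_verts (snd e) q)" by (cases q) (use p e in \<open>auto simp: apath_def awalk_def\<close>)
  then have "snd e = b" using verts * e by auto
  then show ?thesis using * by (metis prod.collapse)
qed

text \<open>The path in the join tree between two of the three hyperedges runs only through
  hyperedges containing their private vertex, hence only through these two, so they are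
  adjacent.\<close>

lemma not_alpha_acyclic_triangle:
  assumes abc: "a \<in> hedges F" "b \<in> hedges F" "c \<in> hedges F" "a \<noteq> b" "b \<noteq> c" "a \<noteq> c"
    and x: "x \<in> a \<inter> b" "\<And>e. e \<in> hedges F \<Longrightarrow> x \<in> e \<Longrightarrow> e = a \<or> e = b"
    and y: "y \<in> b \<inter> c" "\<And>e. e \<in> hedges F \<Longrightarrow> y \<in> e \<Longrightarrow> e = b \<or> e = c"
    and z: "z \<in> c \<inter> a" "\<And>e. e \<in> hedges F \<Longrightarrow> z \<in> e \<Longrightarrow> e = c \<or> e = a"
  shows "\<not> alpha_acyclic_hypergraph F"
proof
  assume "alpha_acyclic_hypergraph F"
  then obtain T where T: "undirected_tree T" "pverts T = hedges F"
    and path: "\<And>e1 e2 e p. e1 \<in> hedges F \<Longrightarrow> e2 \<in> hedges F \<Longrightarrow> e \<in> hedges F \<Longrightarrow>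
      pre_digraph.apath (with_proj T) e1 p e2 \<Longrightarrow>
      e \<in> set (pawalk_verts e1 p) \<Longrightarrow> e1 \<inter> e2 \<subseteq> e"
    unfolding alpha_acyclic_hypergraph_def awalk_verts_with_proj_eq by blast
  interpret pair_graph T using T(1) by (simp add: undirected_tree_def)
  have adj: "(e1, e2) \<in> parcs T"
    if "e1 \<in> hedges F" "e2 \<in> hedges F" "e1 \<noteq> e2" "v \<in> e1 \<inter> e2"
      "\<And>e. e \<in> hedges F \<Longrightarrow> v \<in> e \<Longrightarrow> e = e1 \<or> e = e2" for e1 e2 v
  proof (rule tree_adjacent[OF T(1)])
    fix e p assume p: "apath e1 p e2" "e \<in> set (pawalk_verts e1 p)"
    then have "e \<in> hedges F"
      using pawalk_verts_props[of e1 p e2 T] pair_wf_digraph_axioms T(2)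
      unfolding apath_def awalk_def by auto
    then show "e = e1 \<or> e = e2" using path[of e1 e2 e p] p that by auto
  qed (use that T(2) in auto)
  have "(a, b) \<in> parcs T" "(b, c) \<in> parcs T" "(c, a) \<in> parcs T"
    using adj[of a b x] adj[of b c y] adj[of c a z] abc x y z by auto
  then have "cycle [(a, b), (b, c), (c, a)]"
    unfolding cycle_def awalk_def using abc T(2) by auto
  then show False using T(1) unfolding undirected_tree_def by force
qed

subsection \<open>Long induced cycles from obstructions\<close>

lemma sym_adjacency_rtrancl:
  assumes "\<And>u v. E u v \<Longrightarrow> E v u"
  shows "sym ({(u, v). E u v \<and> u \<in> S \<and> v \<in> S}\<^sup>*)"
  by (rule sym_rtrancl, rule symI) (auto intro: assms)

lemma rtrancl_crossing:
  assumes "(a, b) \<in> r\<^sup>*" "a \<notin> S" "b \<in> S"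
  obtains u v where "(a, u) \<in> r\<^sup>*" "u \<notin> S" "(u, v) \<in> r" "v \<in> S" "(v, b) \<in> r\<^sup>*"
  using assms
proof (induction arbitrary: thesis rule: converse_rtrancl_induct)
  case (step a c)
  show ?case
  proof (cases "c \<in> S")
    case True
    then show thesis using step.prems(1)[of a c] step by auto
  next
    case False
    show thesis
    proof (rule step.IH[OF _ False step.prems(3)])
      fix u v assume "(c, u) \<in> r\<^sup>*" "u \<notin> S" "(u, v) \<in> r" "v \<in> S" "(v, b) \<in> r\<^sup>*"
      then show thesis
        using step.prems(1)[of u v] step.hyps(1) by (meson converse_rtrancl_into_rtrancl)
    qed
  qed
qed simp

lemma Suc_mod_eq: "i < k \<Longrightarrow> Suc i mod k = (if Suc i = k then 0 else Suc i)"
  by auto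

lemma induced_cycleI:
  assumes H: "pair_graph H" and c: "distinct c" "set c \<subseteq> pverts H" "2 \<le> length c"
    and adj: "\<And>i j. i < j \<Longrightarrow> j < length c \<Longrightarrow>
      (c ! i, c ! j) \<in> parcs H \<longleftrightarrow> j = Suc i \<or> i = 0 \<and> j = length c - 1"
  shows "contains_induced_copy H (cycle_graph (length c))"
proof (rule contains_induced_copyI[where \<phi> = "(!) c"])
  interpret pair_graph H by fact
  show "pair_wf_digraph H" by unfold_locales
  show "pair_wf_digraph (cycle_graph (length c))" by (rule pair_wf_digraph_cycle_graph)
  show "inj_on ((!) c) (pverts (cycle_graph (length c)))"
    using c(1) by (auto simp: inj_on_def nth_eq_iff_index_eq)
  show "(!) c ` pverts (cycle_graph (length c)) \<subseteq> pverts H" using c(2) by auto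
  fix i j assume "i \<in> pverts (cycle_graph (length c))" "j \<in> pverts (cycle_graph (length c))"
  then have ij: "i < length c" "j < length c" by simp_all
  have sym: "(u, v) \<in> parcs H \<longleftrightarrow> (v, u) \<in> parcs H" for u v
    using pair_sym_arcs by (auto simp: symmetric_def dest: symD)
  consider "i < j" | "j < i" | "i = j" by linarith
  then show "(c ! i, c ! j) \<in> parcs H \<longleftrightarrow> (i, j) \<in> parcs (cycle_graph (length c))"
  proof cases
    case 1
    then show ?thesis using adj[OF 1 ij(2)] ij by (auto simp: Suc_mod_eq)
  next
    case 2
    then show ?thesis using adj[OF 2 ij(1)] ij sym[of "c ! i" "c ! j"] by (auto simp: Suc_mod_eq)
  next
    case 3
    \<comment> \<open>With at least two vertices, \<open>Suc i mod length c\<close> differs from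
      \<open>i\<close>, so the cycle graph has no loops either.\<close>
    have "(c ! i, c ! i) \<notin> parcs H" using pair_no_loops[of "(c ! i, c ! i)"] by auto
    then show ?thesis using 3 ij c(3) by (auto simp: Suc_mod_eq)
  qed
qed

text \<open>One half of the cycle is a path \<open>p\<close> in \<open>Q\<close>, inside
  \<open>g\<close>, and the other a path \<open>q\<close> in \<open>Z\<close>, outside
  \<open>g\<close>. Edges between the halves occur only at their ends, and each half has at least
  three vertices because no vertex of \<open>Z\<close> reaches both \<open>x\<close> and
  \<open>y\<close>.\<close>

lemma obstruction_imp_long_induced_cycle:
  assumes H: "pair_graph H" and D: "acyclic_orientation H D"
    and obs: "obstruction (hedges (source_hypergraph D)) g W x y"
  shows "\<exists>k\<ge>6. contains_induced_copy H (cycle_graph k)"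
proof -
  interpret H: pair_graph H by fact
  define d where "d = parcs D"
  define adj where "adj u v \<longleftrightarrow> (u, v) \<in> parcs H" for u v
  have DH: "pverts D = pverts H" "d \<subseteq> parcs H"
    "\<And>u v. adj u v \<Longrightarrow> (u, v) \<in> d \<or> (v, u) \<in> d"
    using D by (auto simp: acyclic_orientation_def d_def adj_def)
  have adj_sym: "adj u v \<Longrightarrow> adj v u" for u v
    using H.pair_sym_arcs by (auto simp: adj_def symmetric_def dest: symD)
  have d_adj: "adj u v" "adj v u" if "(u, v) \<in> d" for u v
    using that DH(2) adj_sym[of u v] by (auto simp: adj_def)
  interpret D: pair_wf_digraph D
    using DH(1,2) H.in_arcsD1 H.in_arcsD2 by unfold_locales (auto simp: d_def)
  define R where "R u = {v. (u, v) \<in> d\<^sup>*}" for u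
  have hedges: "hedges (source_hypergraph D) = R ` sources D"
    using reach_set_eq[OF D.pair_wf_digraph_axioms]
    by (auto simp: source_hypergraph_def R_def d_def mem_sources_iff intro!: image_cong)
  have xg: "x \<in> g" and yg: "y \<in> g" and xW: "x \<in> \<Union>W" and yW: "y \<in> \<Union>W"
    and sep: "\<And>e. e \<in> W \<Longrightarrow> x \<in> e \<Longrightarrow> y \<notin> e"
    and conn: "\<And>a b. a \<in> W \<Longrightarrow> b \<in> W \<Longrightarrow> (a, b) \<in> (outside g W)\<^sup>*"
    and gW: "g \<in> R ` sources D" "W \<subseteq> R ` sources D - {g}"
    using obs unfolding obstruction_def hedges by blast+
  obtain s where s: "s \<in> sources D" "g = R s" using gW(1) by blast
  \<comment> \<open>A source inside \<open>g\<close> could only be \<open>s\<close> itself, which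
    would give the hyperedge \<open>g\<close>.\<close>
  have src: "\<exists>t. w = R t \<and> t \<notin> g" if w: "w \<in> W" for w
  proof -
    obtain t where t: "t \<in> sources D" "w = R t" "w \<noteq> g" using w gW(2) by blast
    then have "t \<notin> g" using sources_rtrancl_eq[of t D s] s by (auto simp: R_def d_def)
    then show ?thesis using t by blast
  qed
  have g_fwd: "v \<in> g" if "u \<in> g" "(u, v) \<in> d\<^sup>*" for u v
    using that s(2) by (auto simp: R_def)
  have W_fwd: "v \<in> w" if "w \<in> W" "u \<in> w" "(u, v) \<in> d\<^sup>*" for u v w
    using that src[OF that(1)] by (auto simp: R_def)
  define Z where "Z = \<Union>W - g"
  have noboth: False if "z \<in> Z" "(z, x) \<in> d\<^sup>*" "(z, y) \<in> d\<^sup>*" for z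
    using that W_fwd sep unfolding Z_def by blast
  \<comment> \<open>Since \<open>g\<close> is closed under reachability, edges between
    \<open>Z\<close> and \<open>g\<close> are directed into \<open>g\<close>.\<close>
  have into_g: "(z, u) \<in> d" if "u \<in> g" "z \<in> Z" "adj u z" for u z
    using DH(3)[OF that(3)] g_fwd[OF that(1), of z] that(2) by (auto simp: Z_def)

  define CZ where "CZ = {(u, v). adj u v \<and> u \<in> Z \<and> v \<in> Z}\<^sup>*"
  have symZ: "(u, v) \<in> CZ \<Longrightarrow> (v, u) \<in> CZ" for u v
    unfolding CZ_def using sym_adjacency_rtrancl[of adj Z] adj_sym by (blast dest: symD)
  \<comment> \<open>A directed path from the root \<open>t\<close> to a vertex outside
    \<open>g\<close> never enters \<open>g\<close>, so each hyperedge of \<open>W\<close> stays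
    connected after \<open>g\<close> is removed.\<close>
  have within: "(u, v) \<in> CZ" if w: "w \<in> W" and uv: "u \<in> w - g" "v \<in> w - g" for w u v
  proof -
    obtain t where t: "w = R t" "t \<notin> g" using src[OF w] by blast
    have tZ: "(t, v) \<in> CZ" if "(t, v) \<in> d\<^sup>*" "v \<notin> g" for v
      using that
    proof (induction rule: rtrancl_induct)
      case base
      show ?case by (simp add: CZ_def)
    next
      case (step b c)
      have "b \<notin> g" using g_fwd[of b c] step.hyps(2) step.prems by auto
      moreover have "b \<in> w" "c \<in> w" using step.hyps t(1) by (auto simp: R_def)
      ultimately have "(b, c) \<in> {(u, v). adj u v \<and> u \<in> Z \<and> v \<in> Z}"
        using w step.hyps(2) step.prems d_adj by (auto simp: Z_def)
      then show ?case using step.IH[OF \<open>b \<notin> g\<close>] unfolding CZ_def by (rule rtrancl_into_rtrancl[rotated])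
    qed
    have "(t, u) \<in> CZ" "(t, v) \<in> CZ" using tZ uv t(1) by (auto simp: R_def)
    then show ?thesis using symZ unfolding CZ_def by (meson rtrancl_trans)
  qed
  have chain: "(u, v) \<in> CZ"
    if "(a, b) \<in> (outside g W)\<^sup>*" "a \<in> W" "u \<in> a - g" "v \<in> b - g" for a b u v
    using that
  proof (induction arbitrary: v rule: rtrancl_induct)
    case base
    then show ?case using within by blast
  next
    case (step b c)
    then obtain z where z: "z \<in> b - g" "z \<in> c - g" "c \<in> W" by auto
    have "(u, z) \<in> CZ" using step.IH step.prems z(1) by blast
    moreover have "(z, v) \<in> CZ" using within z(2,3) step.prems(3) by blast
    ultimately show ?case unfolding CZ_def by (rule rtrancl_trans)
  qed
  have connZ: "(u, v) \<in> CZ" if "u \<in> Z" "v \<in> Z" for u v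
    using that chain conn unfolding Z_def by blast

  \<comment> \<open>\<open>Q\<close> consists of the ancestors of \<open>x\<close> or
    \<open>y\<close> in \<open>g\<close>. Directed paths from \<open>s\<close> to members of
    \<open>Q\<close> stay in \<open>Q\<close>, which makes \<open>Q\<close> connected.\<close>
  define Q where "Q = {v \<in> g. (v, x) \<in> d\<^sup>* \<or> (v, y) \<in> d\<^sup>*}"
  define CQ where "CQ = {(u, v). adj u v \<and> u \<in> Q \<and> v \<in> Q}\<^sup>*"
  have symQ: "(u, v) \<in> CQ \<Longrightarrow> (v, u) \<in> CQ" for u v
    unfolding CQ_def using sym_adjacency_rtrancl[of adj Q] adj_sym by (blast dest: symD)
  have sQ: "(s, v) \<in> CQ" if "(s, v) \<in> d\<^sup>*" "v \<in> Q" for v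
    using that
  proof (induction rule: rtrancl_induct)
    case base
    show ?case by (simp add: CQ_def)
  next
    case (step b c)
    have "b \<in> Q"
      using step.hyps step.prems s(2)
      by (auto simp: Q_def R_def intro: converse_rtrancl_into_rtrancl)
    then have "(b, c) \<in> {(u, v). adj u v \<and> u \<in> Q \<and> v \<in> Q}"
      using step.hyps(2) step.prems d_adj by auto
    then show ?case using step.IH[OF \<open>b \<in> Q\<close>] unfolding CQ_def by (rule rtrancl_into_rtrancl[rotated])
  qed
  have connQ: "(u, v) \<in> CQ" if "u \<in> Q" "v \<in> Q" for u v
  proof -
    have "(s, u) \<in> CQ" "(s, v) \<in> CQ" using that sQ s(2) by (auto simp: Q_def R_def)
    then show ?thesis using symQ unfolding CQ_def by (meson rtrancl_trans)
  qed

  \<comment> \<open>The gates of \<open>t\<close> are the ancestors of \<open>t\<close> in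
    \<open>g\<close> that have an arc from \<open>Z\<close>.\<close>
  define gate where "gate t = {v \<in> g. (v, t) \<in> d\<^sup>* \<and> (\<exists>z\<in>Z. (z, v) \<in> d)}" for t
  have gate_ex: "\<exists>v. v \<in> gate t" if t: "t \<in> g" "t \<in> \<Union>W" for t
  proof -
    obtain w r where w: "w \<in> W" "w = R r" "r \<notin> g" "t \<in> w" using t(2) src by blast
    then have "(r, t) \<in> d\<^sup>*" by (simp add: R_def)
    then obtain u v where "(r, u) \<in> d\<^sup>*" "u \<notin> g" "(u, v) \<in> d" "v \<in> g" "(v, t) \<in> d\<^sup>*"
      using rtrancl_crossing[OF _ w(3) t(1)] by blast
    moreover from this have "u \<in> Z" using w by (auto simp: Z_def R_def)
    ultimately show ?thesis by (auto simp: gate_def)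
  qed
  obtain a b where ab: "a \<in> gate x" "b \<in> gate y" using gate_ex xg yg xW yW by blast
  have gateQ: "gate x \<subseteq> Q" "gate y \<subseteq> Q" by (auto simp: gate_def Q_def)
  \<comment> \<open>If gates of \<open>x\<close> and \<open>y\<close> coincide or are adjacent, the
    direction of the edge lets one of the entering vertices of \<open>Z\<close> reach both
    \<open>x\<close> and \<open>y\<close>.\<close>
  have gates: False
    if uv: "u \<in> gate x" "v \<in> gate y" "u = v \<or> adj u v" for u v
  proof -
    obtain z where z: "z \<in> Z" "(z, u) \<in> d" "(u, x) \<in> d\<^sup>*" using uv(1) by (auto simp: gate_def)
    obtain z' where z': "z' \<in> Z" "(z', v) \<in> d" "(v, y) \<in> d\<^sup>*"
      using uv(2) by (auto simp: gate_def)
    consider "(u, v) \<in> d\<^sup>*" | "(v, u) \<in> d\<^sup>*" using uv(3) DH(3)[of u v] by auto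
    then show False
    proof cases
      case 1
      then show False
        using noboth[OF z(1)] z z' by (meson converse_rtrancl_into_rtrancl rtrancl_trans)
    next
      case 2
      then show False
        using noboth[OF z'(1)] z z' by (meson converse_rtrancl_into_rtrancl rtrancl_trans)
    qed
  qed
  have "(a, b) \<in> {(u, v). adj u v \<and> u \<in> Q \<and> v \<in> Q}\<^sup>*"
    using connQ[of a b] ab gateQ by (auto simp: CQ_def)
  then obtain p where p: "p \<noteq> []" "set p \<subseteq> Q" "chordless adj p"
    "\<And>i. i < length p \<Longrightarrow> p ! i \<in> gate x \<longleftrightarrow> i = 0"
    "\<And>i. i < length p \<Longrightarrow> p ! i \<in> gate y \<longleftrightarrow> i = length p - 1"
    by (rule shortest_path_chordless) (use ab gateQ in blast)+
  define l where "l = length p - 1"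
  have l: "l < length p" "p ! 0 \<in> gate x" "p ! l \<in> gate y" using p by (auto simp: l_def)
  have plen: "3 \<le> length p"
  proof (rule ccontr)
    assume "\<not> ?thesis"
    then have "l = 0 \<or> l = 1" "l < length p" using l(1) by (auto simp: l_def)
    then have "p ! 0 = p ! l \<or> adj (p ! 0) (p ! l)" using p(3) by (auto simp: chordless_def)
    then show False using gates l by blast
  qed

  have ends: "\<exists>z\<in>Z. adj v z" if "v \<in> gate t" for v t
    using that d_adj unfolding gate_def by blast
  obtain a' b' where ab': "a' \<in> Z" "adj (p ! 0) a'" "b' \<in> Z" "adj (p ! l) b'"
    using ends l by blast
  have "(a', b') \<in> {(u, v). adj u v \<and> u \<in> Z \<and> v \<in> Z}\<^sup>*"
    using connZ[OF ab'(1,3)] by (simp add: CZ_def)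
  \<comment> \<open>Taking the neighbourhoods of the two ends of \<open>p\<close> as start and
    target sets ensures that only the end vertices of \<open>q\<close> are adjacent to these
    ends.\<close>
  then obtain q where q: "q \<noteq> []" "set q \<subseteq> Z" "chordless adj q"
    and q_ends: "\<And>j. j < length q \<Longrightarrow> q ! j \<in> {z. adj (p ! 0) z} \<longleftrightarrow> j = 0"
      "\<And>j. j < length q \<Longrightarrow> q ! j \<in> {z. adj (p ! l) z} \<longleftrightarrow> j = length q - 1"
    by (rule shortest_path_chordless[where A = "{z. adj (p ! 0) z}" and B = "{z. adj (p ! l) z}"])
      (use ab' in blast)+
  note q = q q_ends[unfolded mem_Collect_eq]
  define m where "m = length q - 1"
  have m: "m < length q" "adj (p ! 0) (q ! 0)" "adj (p ! l) (q ! m)" using q by (auto simp: m_def)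
  have qx: "(q ! 0, x) \<in> d\<^sup>*" and qy: "(q ! m, y) \<in> d\<^sup>*"
  proof -
    have "(q ! 0, p ! 0) \<in> d" "(q ! m, p ! l) \<in> d"
      using into_g m l q(1,2) by (auto simp: gate_def intro!: into_g)
    then show "(q ! 0, x) \<in> d\<^sup>*" "(q ! m, y) \<in> d\<^sup>*"
      using l by (auto simp: gate_def intro: converse_rtrancl_into_rtrancl)
  qed
  have qZ: "q ! j \<in> Z" if "j < length q" for j using q(2) that by auto
  \<comment> \<open>With at most two vertices, one end of \<open>q\<close> would reach the other,
    and hence both \<open>x\<close> and \<open>y\<close>.\<close>
  have qlen: "3 \<le> length q"
  proof (rule ccontr)
    assume "\<not> ?thesis"
    then have "m = 0 \<or> m = 1" using m(1) by (auto simp: m_def)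
    then have "q ! 0 = q ! m \<or> adj (q ! 0) (q ! m)" using q(3) m(1) by (auto simp: chordless_def)
    then consider "(q ! 0, q ! m) \<in> d\<^sup>*" | "(q ! m, q ! 0) \<in> d\<^sup>*" using DH(3) by fastforce
    then show False
    proof cases
      case 1
      then show False using noboth[OF qZ[of 0] qx] qy q(1) by (auto dest: rtrancl_trans)
    next
      case 2
      then show False using noboth[OF qZ[OF m(1)] _ qy] qx by (auto dest: rtrancl_trans)
    qed
  qed

  have cross: "adj (p ! i) (q ! j) \<longleftrightarrow> i = 0 \<and> j = 0 \<or> i = length p - 1 \<and> j = length q - 1"
    if "i < length p" "j < length q" for i j
  proof
    assume pq: "adj (p ! i) (q ! j)"
    have "p ! i \<in> Q" using p(2) that(1) by auto
    then have "p ! i \<in> g" and "(p ! i, x) \<in> d\<^sup>* \<or> (p ! i, y) \<in> d\<^sup>*" by (auto simp: Q_def)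
    \<comment> \<open>A vertex of \<open>Q\<close> with a neighbour in \<open>Z\<close> is a gate,
      and \<open>p\<close> contains gates only at its ends.\<close>
    then have "p ! i \<in> gate x \<or> p ! i \<in> gate y"
      using into_g[OF _ qZ[OF that(2)] pq] qZ[OF that(2)] by (auto simp: gate_def)
    then have "i = 0 \<or> i = l" using p(4,5) that(1) by (auto simp: l_def)
    then show "i = 0 \<and> j = 0 \<or> i = length p - 1 \<and> j = length q - 1"
      using q(4,5)[OF that(2)] pq by (auto simp: l_def)
  next
    assume "i = 0 \<and> j = 0 \<or> i = length p - 1 \<and> j = length q - 1"
    then show "adj (p ! i) (q ! j)" using m by (auto simp: l_def m_def)
  qed
  have "Q \<inter> Z = {}" by (auto simp: Q_def Z_def)
  then have disj: "set p \<inter> set q = {}" using p(2) q(2) by blast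
  have V: "u \<in> pverts H" if "adj u v" for u v using that H.in_arcsD1 by (auto simp: adj_def)
  define c where "c = p @ rev q"
  have len: "length c \<ge> 6" using plen qlen by (simp add: c_def)
  have lens: "2 \<le> length p" "2 \<le> length q" using plen qlen by simp_all
  note cycle = chordless_cycle_append[OF adj_sym p(3) q(3) disj lens cross, folded c_def]
  have "set c \<subseteq> pverts H"
  proof
    fix v assume "v \<in> set c"
    then obtain i where i: "i < length c" "v = c ! i" by (auto simp: in_set_conv_nth)
    show "v \<in> pverts H"
    proof (cases "Suc i < length c")
      case True
      then show ?thesis using cycle(2)[of i "Suc i"] V i(2) by auto
    next
      case False
      then have "adj (c ! (i - 1)) (c ! i)" using cycle(2)[of "i - 1" i] i(1) len by auto
      then show ?thesis using V adj_sym i(2) by blast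
    qed
  qed
  then have "contains_induced_copy H (cycle_graph (length c))"
    using induced_cycleI[OF H cycle(1)] cycle(2) len by (auto simp: adj_def)
  then show ?thesis using len by blast
qed

lemma no_long_induced_cycle_imp_alpha_acyclic:
  assumes H: "pair_graph H" and no: "\<forall>k\<ge>6. \<not> contains_induced_copy H (cycle_graph k)"
  shows "alpha_acyclic_graph H"
  unfolding alpha_acyclic_graph_def alpha_acyclic_dag_def
proof (intro allI impI)
  interpret pair_graph H by fact
  fix D assume D: "acyclic_orientation H D"
  let ?U = "hedges (source_hypergraph D)"
  have "finite (pverts D)" using D pair_finite_verts by (simp add: acyclic_orientation_def)
  then have fin: "finite ?U" by (auto simp: source_hypergraph_def sources_def)
  have no_obs: "\<not> obstruction ?U g W x y" for g W x y
    using obstruction_imp_long_induced_cycle[OF H D] no by blast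
  obtain es where "rip es" "set es = ?U"
  \<comment> \<open>An empty family offers no hyperedge \<open>g\<close> to serve as root.\<close>
  proof (cases "?U = {}")
    case True
    then show thesis using that[of "[]"] by simp
  next
    case False
    then show thesis using rip_if_no_obstruction[OF fin _ no_obs] that by blast
  qed
  then show "alpha_acyclic_hypergraph (source_hypergraph D)"
    using rip_imp_join_tree[of es] alpha_acyclic_hypergraphI[OF fin] by auto
qed

subsection \<open>Orienting a long induced cycle\<close>

lemma rtrancl_closed_backwards:
  assumes "(u, v) \<in> r\<^sup>*" "v \<in> A" "\<And>u w. w \<in> A \<Longrightarrow> (u, w) \<in> r \<Longrightarrow> u \<in> A"
  shows "u \<in> A"
  using assms(1,2) by (induction rule: converse_rtrancl_induct) (auto intro: assms(3))

text \<open>Sources 0, 2, 4 and sinks 1, 3, 5; the rest of the cycle becomes a directed path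
  from 0 down to 5.\<close>
definition cycle_rank :: "nat \<Rightarrow> nat \<Rightarrow> nat" where
  "cycle_rank k i = (if i \<in> {0, 2, 4} then 0 else if i \<in> {1, 3, 5} then k else k - i)"

lemma cycle_rank_Suc_neq: "6 \<le> k \<Longrightarrow> i < k \<Longrightarrow> cycle_rank k i \<noteq> cycle_rank k (Suc i mod k)"
  by (auto simp: cycle_rank_def Suc_mod_eq)

text \<open>All edges point towards higher rank. Vertices off the cycle receive pairwise different
  ranks above \<open>k\<close>, so arcs entering a cycle vertex come from the cycle alone.\<close>

lemma cycle_rank_orientation:
  assumes H: "pair_graph H" and k: "6 \<le> k"
    and inj: "inj_on \<phi> {..<k}"
    and adj: "\<And>i j. i < k \<Longrightarrow> j < k \<Longrightarrow>
      (\<phi> i, \<phi> j) \<in> parcs H \<longleftrightarrow> j = Suc i mod k \<or> i = Suc j mod k"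
  obtains D where "acyclic_orientation H D"
    "\<And>u j. j < k \<Longrightarrow> (u, \<phi> j) \<in> parcs D \<longleftrightarrow> (\<exists>i<k. u = \<phi> i \<and> cycle_rank k i < cycle_rank k j \<and>
      (j = Suc i mod k \<or> i = Suc j mod k))"
proof -
  interpret pair_graph H by fact
  obtain f :: "'a \<Rightarrow> nat" where f: "inj_on f (pverts H)"
    using finite_imp_inj_to_nat_seg[OF pair_finite_verts] by blast
  define rank where "rank u = (if u \<in> \<phi> ` {..<k}
    then cycle_rank k (the_inv_into {..<k} \<phi> u) else Suc (k + f u))" for u
  have rank_\<phi>: "rank (\<phi> i) = cycle_rank k i" if "i < k" for i
    using that the_inv_into_f_f[OF inj, of i] by (simp add: rank_def)
  have rank_le: "cycle_rank k i \<le> k" for i by (simp add: cycle_rank_def)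
  define D where "D = \<lparr>pverts = pverts H, parcs = {(u, v) \<in> parcs H. rank u < rank v}\<rparr>"
  have sym: "(v, u) \<in> parcs H" if "(u, v) \<in> parcs H" for u v
    using that pair_sym_arcs by (auto simp: symmetric_def dest: symD)
  have neq: "rank u \<noteq> rank v" if uv: "(u, v) \<in> parcs H" for u v
  proof (cases "u \<in> \<phi> ` {..<k}"; cases "v \<in> \<phi> ` {..<k}")
    assume "u \<in> \<phi> ` {..<k}" "v \<in> \<phi> ` {..<k}"
    then obtain i j where ij: "i < k" "j < k" "u = \<phi> i" "v = \<phi> j" by auto
    then have "j = Suc i mod k \<or> i = Suc j mod k" using adj uv by simp
    then show ?thesis
      using cycle_rank_Suc_neq[OF k ij(1)] cycle_rank_Suc_neq[OF k ij(2)] ij rank_\<phi> by metis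
  next
    assume "u \<notin> \<phi> ` {..<k}" "v \<notin> \<phi> ` {..<k}"
    then have "rank u = Suc (k + f u)" "rank v = Suc (k + f v)" by (simp_all add: rank_def)
    moreover have "u \<noteq> v" "u \<in> pverts H" "v \<in> pverts H"
      using uv pair_no_loops[of "(u, v)"] in_arcsD1 in_arcsD2 by auto
    ultimately show ?thesis using f by (auto dest: inj_onD)
  next
    assume uv': "u \<in> \<phi> ` {..<k}" "v \<notin> \<phi> ` {..<k}"
    then have "rank u \<le> k" using rank_\<phi> rank_le by auto
    moreover have "rank v > k" using uv' by (simp add: rank_def)
    ultimately show ?thesis by simp
  next
    assume uv': "u \<notin> \<phi> ` {..<k}" "v \<in> \<phi> ` {..<k}"
    then have "rank v \<le> k" using rank_\<phi> rank_le by auto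
    moreover have "rank u > k" using uv' by (simp add: rank_def)
    ultimately show ?thesis by simp
  qed
  have "parcs D \<subseteq> measure rank" by (auto simp: D_def)
  then have "acyclic (parcs D)" using wf_acyclic wf_subset wf_measure by blast
  moreover have "(u, v) \<in> parcs D \<longleftrightarrow> (v, u) \<notin> parcs D" if "(u, v) \<in> parcs H" for u v
    using that sym[OF that] neq[OF that] by (auto simp: D_def)
  ultimately have "acyclic_orientation H D"
    unfolding acyclic_orientation_def by (auto simp: D_def)
  moreover have "(u, \<phi> j) \<in> parcs D \<longleftrightarrow> (\<exists>i<k. u = \<phi> i \<and> cycle_rank k i < cycle_rank k j \<and>
      (j = Suc i mod k \<or> i = Suc j mod k))" if j: "j < k" for u j
  proof
    assume u: "(u, \<phi> j) \<in> parcs D"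
    then have "rank u \<le> k" using rank_\<phi>[OF j] rank_le[of j] by (simp add: D_def)
    then obtain i where i: "i < k" "u = \<phi> i" by (auto simp: rank_def split: if_splits)
    then show "\<exists>i<k. u = \<phi> i \<and> cycle_rank k i < cycle_rank k j \<and>
        (j = Suc i mod k \<or> i = Suc j mod k)"
      using u rank_\<phi> j adj by (auto simp: D_def)
  qed (use rank_\<phi> j adj in \<open>auto simp: D_def\<close>)
  ultimately show thesis using that by blast
qed

text \<open>The reachability sets of the cycle vertices 0, 2, 4 form the forbidden triangle, with
  the sinks 1, 3, 5 as the vertices private to its pairs. Sources off the cycle never reach
  it.\<close>

lemma long_induced_cycle_imp_not_alpha_acyclic:
  assumes H: "pair_graph H" and k: "6 \<le> k" and copy: "contains_induced_copy H (cycle_graph k)"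
  shows "\<not> alpha_acyclic_graph H"
proof -
  interpret H: pair_graph H by fact
  obtain \<phi> where inj: "inj_on \<phi> {..<k}" and sub: "\<phi> ` {..<k} \<subseteq> pverts H"
    and adj: "\<And>i j. i < k \<Longrightarrow> j < k \<Longrightarrow>
      (\<phi> i, \<phi> j) \<in> parcs H \<longleftrightarrow> j = Suc i mod k \<or> i = Suc j mod k"
    using contains_induced_copyD[OF copy]
    by (simp add: cycle_graph_def atLeast0LessThan) blast
  obtain D where D: "acyclic_orientation H D"
    and arcs: "\<And>u j. j < k \<Longrightarrow> (u, \<phi> j) \<in> parcs D \<longleftrightarrow>
      (\<exists>i<k. u = \<phi> i \<and> cycle_rank k i < cycle_rank k j \<and> (j = Suc i mod k \<or> i = Suc j mod k))"
    using cycle_rank_orientation[OF H k inj adj] by blast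
  have DH: "pverts D = pverts H" "parcs D \<subseteq> parcs H"
    using D by (auto simp: acyclic_orientation_def)
  interpret D: pair_wf_digraph D
    using DH H.in_arcsD1 H.in_arcsD2 by unfold_locales auto
  define R where "R = reach_set D"
  have R: "v \<in> R u \<longleftrightarrow> (u, v) \<in> (parcs D)\<^sup>*" if "u \<in> sources D" for u v
    using that reach_set_eq[OF D.pair_wf_digraph_axioms] by (auto simp: R_def mem_sources_iff)
  have src: "\<phi> i \<in> sources D" if "i \<in> {0, 2, 4}" for i
  proof -
    have "i < k" "cycle_rank k i = 0" using that k by (auto simp: cycle_rank_def)
    then show ?thesis using arcs[of i] sub DH(1) by (auto simp: mem_sources_iff)
  qed
  have nosrc: "\<phi> i \<notin> sources D" if "i < k" "i \<notin> {0, 2, 4}" for i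
  proof -
    \<comment> \<open>A sink is entered from its predecessor on the cycle. Any other vertex, with
      index at least 6, is entered from its successor, which is 0 after k - 1.\<close>
    have "\<exists>j<k. cycle_rank k j < cycle_rank k i \<and> (i = Suc j mod k \<or> j = Suc i mod k)"
    proof (cases "i \<in> {1, 3, 5}")
      case True
      then show ?thesis using k by (intro exI[of _ "i - 1"]) (auto simp: cycle_rank_def)
    next
      case False
      then show ?thesis using that k
        by (intro exI[of _ "Suc i mod k"]) (auto simp: cycle_rank_def Suc_mod_eq)
    qed
    then show ?thesis using arcs[OF that(1)] by (auto simp: mem_sources_iff)
  qed
  \<comment> \<open>A set of indices closed under cycle neighbours of lower rank contains the index
    of every vertex that reaches one of its members.\<close>
  have pre: "u \<in> \<phi> ` A"
    if u: "(u, \<phi> j) \<in> (parcs D)\<^sup>*" and A: "j \<in> A" "A \<subseteq> {..<k}"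
      "\<And>i j. i < k \<Longrightarrow> j \<in> A \<Longrightarrow> cycle_rank k i < cycle_rank k j \<Longrightarrow>
        j = Suc i mod k \<or> i = Suc j mod k \<Longrightarrow> i \<in> A" for u j A
  proof (rule rtrancl_closed_backwards[OF u])
    show "\<phi> j \<in> \<phi> ` A" using A(1) by blast
    fix u w assume "w \<in> \<phi> ` A" "(u, w) \<in> parcs D"
    then obtain j where j: "j \<in> A" "(u, \<phi> j) \<in> parcs D" by blast
    then have "j < k" using A(2) by auto
    then show "u \<in> \<phi> ` A" using arcs[of j u] j A(3) by blast
  qed
  \<comment> \<open>The directed path goes from 0 to k - 1 and then down to \<open>j\<close>, hence
    the induction on k - j.\<close>
  have path: "(\<phi> 0, \<phi> j) \<in> (parcs D)\<^sup>*" if "5 \<le> j" "j < k" for j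
    using that
  proof (induction "k - j" arbitrary: j rule: less_induct)
    case less
    define i where "i = Suc j mod k"
    have "(\<phi> 0, \<phi> i) \<in> (parcs D)\<^sup>*"
      using less.hyps[of "Suc j"] less.prems by (auto simp: i_def Suc_mod_eq)
    moreover have "(\<phi> i, \<phi> j) \<in> parcs D"
      unfolding arcs[OF less.prems(2)]
      using less.prems k by (intro exI[of _ i]) (auto simp: i_def cycle_rank_def Suc_mod_eq)
    ultimately show ?case by (rule rtrancl_into_rtrancl)
  qed
  have arc: "(\<phi> i, \<phi> j) \<in> parcs D" if "i \<in> {0, 2, 4}" "j \<in> {1, 3, 5}" "j = Suc i \<or> i = Suc j" for i j
  proof -
    have "i < k" "j < k" "cycle_rank k i = 0" "cycle_rank k j = k"
      using that k by (auto simp: cycle_rank_def)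
    moreover have "j = Suc i mod k \<or> i = Suc j mod k"
      using that(3) \<open>i < k\<close> \<open>j < k\<close> by auto
    ultimately show ?thesis using arcs[of j "\<phi> i"] k by auto
  qed
  have neq: "R (\<phi> i) \<noteq> R (\<phi> j)" if ij: "i \<in> {0, 2, 4}" "j \<in> {0, 2, 4}" "i \<noteq> j" for i j
  proof
    assume "R (\<phi> i) = R (\<phi> j)"
    then have "(\<phi> j, \<phi> i) \<in> (parcs D)\<^sup>*" using R src ij by blast
    then have "\<phi> j = \<phi> i" using sources_rtrancl_eq src ij(1) by metis
    moreover have "i < k" "j < k" using ij k by auto
    ultimately show False using inj_onD[OF inj, of j i] ij(3) by simp
  qed
  have hedges: "hedges (source_hypergraph D) = R ` sources D"
    by (simp add: source_hypergraph_def R_def)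
  have only: "e = R (\<phi> a) \<or> e = R (\<phi> b)"
    if e: "e \<in> hedges (source_hypergraph D)" "\<phi> j \<in> e" and A: "j \<in> A" "A \<subseteq> {..<k}"
      "\<And>i j. i < k \<Longrightarrow> j \<in> A \<Longrightarrow> cycle_rank k i < cycle_rank k j \<Longrightarrow>
        j = Suc i mod k \<or> i = Suc j mod k \<Longrightarrow> i \<in> A"
      and ab: "A \<inter> {0, 2, 4} \<subseteq> {a, b}" for e j A a b
  proof -
    obtain u where u: "u \<in> sources D" "e = R u" using e(1) hedges by blast
    then have "(u, \<phi> j) \<in> (parcs D)\<^sup>*" using e(2) R by simp
    then have "u \<in> \<phi> ` A" using A by (rule pre)
    then obtain i where i: "i \<in> A" "u = \<phi> i" by blast
    have "i < k" using i(1) A(2) by auto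
    then have "i \<in> {0, 2, 4}" using nosrc[of i] u(1) i(2) by metis
    then have "i = a \<or> i = b" using i(1) ab by auto
    then show ?thesis using i(2) u(2) by auto
  qed
  \<comment> \<open>The ancestors of each sink lie on an arc of the cycle that contains two of the
    three sources. For sink 5 this arc runs from 4 around to 0.\<close>
  have only1: "e = R (\<phi> 0) \<or> e = R (\<phi> 2)"
    if "e \<in> hedges (source_hypergraph D)" "\<phi> 1 \<in> e" for e
    by (rule only[OF that, of "{0, 1, 2}"])
      (use k in \<open>auto simp: cycle_rank_def Suc_mod_eq split: if_splits\<close>)
  have only3: "e = R (\<phi> 2) \<or> e = R (\<phi> 4)"
    if "e \<in> hedges (source_hypergraph D)" "\<phi> 3 \<in> e" for e
    by (rule only[OF that, of "{2, 3, 4}"])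
      (use k in \<open>auto simp: cycle_rank_def Suc_mod_eq split: if_splits\<close>)
  have only5: "e = R (\<phi> 4) \<or> e = R (\<phi> 0)"
    if "e \<in> hedges (source_hypergraph D)" "\<phi> 5 \<in> e" for e
    by (rule only[OF that, of "insert 0 {4..<k}"])
      (use k in \<open>auto simp: cycle_rank_def Suc_mod_eq split: if_splits\<close>)
  have in_R: "\<phi> j \<in> R (\<phi> i)" if "i \<in> {0, 2, 4}" "j \<in> {1, 3, 5}" "j = Suc i \<or> i = Suc j" for i j
    using R[OF src[OF that(1)]] arc[OF that] by auto
  \<comment> \<open>The vertices 5 and 0 are adjacent only for k = 6; in general the long directed
    path is needed.\<close>
  have "\<phi> 5 \<in> R (\<phi> 0)" using R[OF src[of 0]] path[of 5] k by auto
  then have "\<not> alpha_acyclic_hypergraph (source_hypergraph D)"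
    using in_R src neq only1 only3 only5 hedges
    by (intro not_alpha_acyclic_triangle[where a = "R (\<phi> 0)" and b = "R (\<phi> 2)" and c = "R (\<phi> 4)"
          and x = "\<phi> 1" and y = "\<phi> 3" and z = "\<phi> 5"]) simp_all
  then show ?thesis using D unfolding alpha_acyclic_graph_def alpha_acyclic_dag_def by blast
qed

theorem theorem1p7:
  fixes H :: "'a pair_pre_digraph"
  assumes "pair_graph H"
  shows "alpha_acyclic_graph H \<longleftrightarrow>
           (\<forall>k\<ge>6. \<not> contains_induced_copy H (cycle_graph k))"
  using no_long_induced_cycle_imp_alpha_acyclic[OF assms]
    long_induced_cycle_imp_not_alpha_acyclic[OF assms] by blast

end
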